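(* A projectively flat Finsler metric with non-zero scalar curvature does not admit (nonzero) parallel 1-forms.
   Context: $M$ is a smooth manifold of dimension $n\ge 2$, $\mathcal{T}M$ is the bundle of nonzero tangent vectors, $(x^i,y^i)$ are the induced coordinates on $TM$, $\partial_i=\partial/\partial x^i$, $\dot\partial_i=\partial/\partial y^i$; the summation convention is used. A Finsler metric on $M$ is a function $F:TM\to\mathbb{R}$ that is strictly positive and smooth on $\mathcal{T}M$, positively 1-homogeneous in $y$, and such that $g_{ij}=\dot\partial_i\dot\partial_j(\tfrac12F^2)$ has rank $n$; $y_i=g_{ij}y^j$. Its geodesic spray is $S=y^j\partial_j-2G^j\dot\partial_j$, with $G^i=\tfrac14 g^{il}\left(y^k\partial_k\dot\partial_l F^2-\partial_l F^2\right)$. Put $N^h_j=\dot\partial_jG^h$ and $G^h_{ij}=\dot\partial_iN^h_j$ (Berwald connection coefficients). $F$ is projectively flat if around each point there are coordinates in which $G^i=\mathcal{P}(x,y)\,y^i$ for some function $\mathcal{P}$ (equivalently, the geodesics are straight lines as point sets). The Riemann curvature is $R^i_j=2\partial_jG^i-S(N^i_j)-N^i_kN^k_j$. $F$ has scalar (flag) curvature $K$ if $R^h_i=K\,(F^2\delta^h_i-y_iy^h)$ with $K(x,y)$ a smooth function on $\mathcal{T}M$; every projectively flat Finsler metric has scalar curvature. Non-zero scalar curvature means $K\neq0$ on $\mathcal{T}M$. A 1-form $\beta=b_i(x)y^i$ is parallel if its Berwald horizontal covariant derivative vanishes: $b_{i|j}=\partial_jb_i-G^h_{ij}b_h=0$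 on $\mathcal{T}M$. Parallel 1-forms are understood to be nonzero. *)

theory Defs
  imports "HOL-Analysis.Analysis"
begin

section \<open>Smooth functions on open sets\<close>

text \<open>Meant for open sets only. A map is of class \<open>C\<^sup>k\<^sup>+\<^sup>1\<close> if it is differentiable and
  all its directional derivatives are of class \<open>C\<^sup>k\<close>.\<close>

fun Ck_on :: "nat \<Rightarrow> ('e::euclidean_space \<Rightarrow> 'f::real_normed_vector) \<Rightarrow> 'e set \<Rightarrow> bool" where
  "Ck_on 0 f S = continuous_on S f"
| "Ck_on (Suc k) f S =
     ((\<forall>x\<in>S. f differentiable (at x)) \<and>
      (\<forall>v. Ck_on k (\<lambda>x. frechet_derivative f (at x) v) S))"

definition smooth_on :: "('e::euclidean_space \<Rightarrow> 'f::real_normed_vector) \<Rightarrow> 'e set \<Rightarrow> bool" where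
  "smooth_on f S \<longleftrightarrow> (\<forall>k. Ck_on k f S)"

section \<open>Smooth manifolds\<close>

text \<open>A chart is a pair of an open domain and a coordinate map; the values of the coordinate
  map outside the domain are irrelevant.\<close>

type_synonym ('a, 'n) chart = "'a set \<times> ('a \<Rightarrow> real ^ 'n)"

definition is_chart :: "'a topology \<Rightarrow> ('a, 'n::finite) chart \<Rightarrow> bool" where
  "is_chart M c \<longleftrightarrow> openin M (fst c) \<and> open (snd c ` fst c) \<and>
     homeomorphic_map (subtopology M (fst c)) (top_of_set (snd c ` fst c)) (snd c)"

definition transition ::
  "('a, 'n::finite) chart \<Rightarrow> ('a, 'n) chart \<Rightarrow> real ^ 'n \<Rightarrow> real ^ 'n" where
  "transition c d = snd d \<circ> inv_into (fst c) (snd c)"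

definition smoothly_compatible :: "('a, 'n::finite) chart \<Rightarrow> ('a, 'n) chart \<Rightarrow> bool" where
  "smoothly_compatible c d \<longleftrightarrow>
     smooth_on (transition c d) (snd c ` (fst c \<inter> fst d)) \<and>
     smooth_on (transition d c) (snd d ` (fst c \<inter> fst d))"

text \<open>A smooth manifold of dimension \<open>CARD('n)\<close>: a Hausdorff, second countable space \<open>M\<close> with a
  maximal smooth atlas \<open>A\<close>. By maximality, ``coordinates'' on \<open>M\<close> are the elements of \<open>A\<close>.\<close>

definition smooth_manifold :: "'a topology \<Rightarrow> ('a, 'n::finite) chart set \<Rightarrow> bool" where
  "smooth_manifold M A \<longleftrightarrow> Hausdorff_space M \<and> second_countable M \<and>
     (\<forall>c\<in>A. is_chart M c) \<and>
     (\<Union>c\<in>A. fst c) = topspace M \<and>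
     (\<forall>c\<in>A. \<forall>d\<in>A. smoothly_compatible c d) \<and>
     (\<forall>c. is_chart M c \<and> (\<forall>d\<in>A. smoothly_compatible c d) \<longrightarrow> c \<in> A)"

section \<open>The tangent bundle\<close>

text \<open>A tangent vector at \<open>p\<close> is a family of component vectors, one for each chart around \<open>p\<close>,
  transforming by the derivatives of the transition maps. The family is set to 0 at the pairs
  that are not charts around \<open>p\<close>.\<close>

type_synonym ('a, 'n) tvec = "'a \<times> (('a, 'n) chart \<Rightarrow> real ^ 'n)"

definition tangent_bundle ::
  "'a topology \<Rightarrow> ('a, 'n::finite) chart set \<Rightarrow> ('a, 'n) tvec set" where
  "tangent_bundle M A = {(p, v). p \<in> topspace M \<and>
     (\<forall>c\<in>A. \<forall>d\<in>A. p \<in> fst c \<and> p \<in> fst d \<longrightarrow>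
        v d = frechet_derivative (transition c d) (at (snd c p)) (v c)) \<and>
     (\<forall>c. c \<notin> A \<or> p \<notin> fst c \<longrightarrow> v c = 0)}"

definition slit_tangent_bundle ::
  "'a topology \<Rightarrow> ('a, 'n::finite) chart set \<Rightarrow> ('a, 'n) tvec set" where
  "slit_tangent_bundle M A = {(p, v) \<in> tangent_bundle M A. v \<noteq> (\<lambda>_. 0)}"

text \<open>The tangent vector \<open>y\<^sup>i \<partial>\<^sub>i\<close> at the point with coordinates \<open>x\<close> in the chart \<open>c\<close>, that is,
  the inverse of the chart \<open>(x\<^sup>i, y\<^sup>i)\<close> of the tangent bundle induced by \<open>c\<close>.\<close>

definition induced ::
  "('a, 'n::finite) chart set \<Rightarrow> ('a, 'n) chart \<Rightarrow> (real ^ 'n) \<times> (real ^ 'n) \<Rightarrow> ('a, 'n) tvec"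
  where
  "induced A c = (\<lambda>(x, y). let p = inv_into (fst c) (snd c) x in
     (p, \<lambda>d. if d \<in> A \<and> p \<in> fst d then frechet_derivative (transition c d) (at x) y else 0))"

definition local_rep ::
  "('a, 'n::finite) chart set \<Rightarrow> ('a, 'n) chart \<Rightarrow> (('a, 'n) tvec \<Rightarrow> real) \<Rightarrow>
   (real ^ 'n) \<times> (real ^ 'n) \<Rightarrow> real" where
  "local_rep A c f = f \<circ> induced A c"

definition slit_domain :: "('a, 'n::finite) chart \<Rightarrow> ((real ^ 'n) \<times> (real ^ 'n)) set" where
  "slit_domain c = (snd c ` fst c) \<times> (- {0})"

definition smooth_on_slit ::
  "('a, 'n::finite) chart set \<Rightarrow> (('a, 'n) tvec \<Rightarrow> real) \<Rightarrow> bool" where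
  "smooth_on_slit A f \<longleftrightarrow> (\<forall>c\<in>A. smooth_on (local_rep A c f) (slit_domain c))"

section \<open>Finsler geometry in induced coordinates\<close>

text \<open>In this section \<open>L\<close> stands for the coordinate expression \<open>L(x, y)\<close> of a Finsler
  metric.\<close>

definition dx :: "'n::finite \<Rightarrow> ((real ^ 'n) \<times> (real ^ 'n) \<Rightarrow> real) \<Rightarrow>
    (real ^ 'n) \<times> (real ^ 'n) \<Rightarrow> real" where
  "dx i f z = frechet_derivative f (at z) (axis i 1, 0)"

definition dy :: "'n::finite \<Rightarrow> ((real ^ 'n) \<times> (real ^ 'n) \<Rightarrow> real) \<Rightarrow>
    (real ^ 'n) \<times> (real ^ 'n) \<Rightarrow> real" where
  "dy i f z = frechet_derivative f (at z) (0, axis i 1)"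

definition metric_tensor :: "((real ^ 'n::finite) \<times> (real ^ 'n) \<Rightarrow> real) \<Rightarrow>
    (real ^ 'n) \<times> (real ^ 'n) \<Rightarrow> real ^ 'n ^ 'n" where
  "metric_tensor L z = (\<chi> i j. dy i (dy j (\<lambda>w. (L w)\<^sup>2 / 2)) z)"

definition lowered_y :: "((real ^ 'n::finite) \<times> (real ^ 'n) \<Rightarrow> real) \<Rightarrow> 'n \<Rightarrow>
    (real ^ 'n) \<times> (real ^ 'n) \<Rightarrow> real" where
  "lowered_y L i z = (\<Sum>j\<in>UNIV. metric_tensor L z $ i $ j * snd z $ j)"

definition spray_coeff :: "((real ^ 'n::finite) \<times> (real ^ 'n) \<Rightarrow> real) \<Rightarrow> 'n \<Rightarrow>
    (real ^ 'n) \<times> (real ^ 'n) \<Rightarrow> real" where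
  "spray_coeff L i z = 1/4 * (\<Sum>l\<in>UNIV. matrix_inv (metric_tensor L z) $ i $ l *
     ((\<Sum>k\<in>UNIV. snd z $ k * dx k (dy l (\<lambda>w. (L w)\<^sup>2)) z) - dx l (\<lambda>w. (L w)\<^sup>2) z))"

definition spray :: "((real ^ 'n::finite) \<times> (real ^ 'n) \<Rightarrow> real) \<Rightarrow>
    ((real ^ 'n) \<times> (real ^ 'n) \<Rightarrow> real) \<Rightarrow> (real ^ 'n) \<times> (real ^ 'n) \<Rightarrow> real" where
  "spray L f z = (\<Sum>j\<in>UNIV. snd z $ j * dx j f z) - 2 * (\<Sum>j\<in>UNIV. spray_coeff L j z * dy j f z)"

definition nonlinear_conn :: "((real ^ 'n::finite) \<times> (real ^ 'n) \<Rightarrow> real) \<Rightarrow> 'n \<Rightarrow> 'n \<Rightarrow>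
    (real ^ 'n) \<times> (real ^ 'n) \<Rightarrow> real" where
  "nonlinear_conn L h j = dy j (spray_coeff L h)"

definition berwald_conn :: "((real ^ 'n::finite) \<times> (real ^ 'n) \<Rightarrow> real) \<Rightarrow> 'n \<Rightarrow> 'n \<Rightarrow> 'n \<Rightarrow>
    (real ^ 'n) \<times> (real ^ 'n) \<Rightarrow> real" where
  "berwald_conn L h i j = dy i (nonlinear_conn L h j)"

definition riemann_curv :: "((real ^ 'n::finite) \<times> (real ^ 'n) \<Rightarrow> real) \<Rightarrow> 'n \<Rightarrow> 'n \<Rightarrow>
    (real ^ 'n) \<times> (real ^ 'n) \<Rightarrow> real" where
  "riemann_curv L i j z = 2 * dx j (spray_coeff L i) z - spray L (nonlinear_conn L i j) z
     - (\<Sum>k\<in>UNIV. nonlinear_conn L i k z * nonlinear_conn L k j z)"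

section \<open>Finsler metrics and 1-forms on a manifold\<close>

definition finsler_metric ::
  "'a topology \<Rightarrow> ('a, 'n::finite) chart set \<Rightarrow> (('a, 'n) tvec \<Rightarrow> real) \<Rightarrow> bool" where
  "finsler_metric M A F \<longleftrightarrow>
     (\<forall>u \<in> slit_tangent_bundle M A. F u > 0) \<and>
     smooth_on_slit A F \<and>
     (\<forall>(p, v) \<in> tangent_bundle M A. \<forall>t>0. F (p, \<lambda>c. t *\<^sub>R v c) = t * F (p, v)) \<and>
     (\<forall>c\<in>A. \<forall>z \<in> slit_domain c. rank (metric_tensor (local_rep A c F) z) = CARD('n))"

definition projectively_flat ::
  "'a topology \<Rightarrow> ('a, 'n::finite) chart set \<Rightarrow> (('a, 'n) tvec \<Rightarrow> real) \<Rightarrow> bool" where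
  "projectively_flat M A F \<longleftrightarrow>
     (\<forall>p \<in> topspace M. \<exists>c\<in>A. p \<in> fst c \<and>
        (\<exists>P. \<forall>z \<in> slit_domain c. \<forall>i. spray_coeff (local_rep A c F) i z = P z * snd z $ i))"

definition has_scalar_curvature ::
  "('a, 'n::finite) chart set \<Rightarrow> (('a, 'n) tvec \<Rightarrow> real) \<Rightarrow> (('a, 'n) tvec \<Rightarrow> real) \<Rightarrow> bool" where
  "has_scalar_curvature A F K \<longleftrightarrow> smooth_on_slit A K \<and>
     (\<forall>c\<in>A. \<forall>z \<in> slit_domain c. \<forall>h i.
        riemann_curv (local_rep A c F) h i z =
          local_rep A c K z * ((local_rep A c F z)\<^sup>2 * (if h = i then 1 else 0)
            - lowered_y (local_rep A c F) i z * snd z $ h))"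

text \<open>1-forms are fibrewise linear functions on the tangent bundle; \<open>form_coeff A c \<beta> i\<close> is the
  coefficient \<open>b\<^sub>i = \<beta>(\<partial>\<^sub>i)\<close> in the chart \<open>c\<close>.\<close>

definition form_coeff ::
  "('a, 'n::finite) chart set \<Rightarrow> ('a, 'n) chart \<Rightarrow> (('a, 'n) tvec \<Rightarrow> real) \<Rightarrow> 'n \<Rightarrow>
   real ^ 'n \<Rightarrow> real" where
  "form_coeff A c \<beta> i x = local_rep A c \<beta> (x, axis i 1)"

definition one_form ::
  "('a, 'n::finite) chart set \<Rightarrow> (('a, 'n) tvec \<Rightarrow> real) \<Rightarrow> bool" where
  "one_form A \<beta> \<longleftrightarrow> (\<forall>c\<in>A.
     (\<forall>i. smooth_on (form_coeff A c \<beta> i) (snd c ` fst c)) \<and>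
     (\<forall>x \<in> snd c ` fst c. \<forall>y.
        local_rep A c \<beta> (x, y) = (\<Sum>i\<in>UNIV. form_coeff A c \<beta> i x * y $ i)))"

definition horizontal_deriv ::
  "((real ^ 'n::finite) \<times> (real ^ 'n) \<Rightarrow> real) \<Rightarrow> ('n \<Rightarrow> real ^ 'n \<Rightarrow> real) \<Rightarrow> 'n \<Rightarrow> 'n \<Rightarrow>
   (real ^ 'n) \<times> (real ^ 'n) \<Rightarrow> real" where
  "horizontal_deriv L b i j z = frechet_derivative (b i) (at (fst z)) (axis j 1)
     - (\<Sum>h\<in>UNIV. berwald_conn L h i j z * b h (fst z))"

definition parallel_form ::
  "('a, 'n::finite) chart set \<Rightarrow> (('a, 'n) tvec \<Rightarrow> real) \<Rightarrow> (('a, 'n) tvec \<Rightarrow> real) \<Rightarrow> bool" where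
  "parallel_form A F \<beta> \<longleftrightarrow> one_form A \<beta> \<and>
     (\<forall>c\<in>A. \<forall>z \<in> slit_domain c. \<forall>i j.
        horizontal_deriv (local_rep A c F) (form_coeff A c \<beta>) i j z = 0)"

end

theory Submission
  imports Defs
begin

text \<open>
  Every parallel 1-form is annihilated by the curvature in all directions \<open>y\<close>. A curvature
  \<open>R\<^sup>h\<^sub>i = K (F\<^sup>2 \<delta>\<^sup>h\<^sub>i - y\<^sub>i y\<^sup>h)\<close> with \<open>K \<noteq> 0\<close>, however, acts on a 1-form with
  \<open>\<beta>(y) = 0\<close> as multiplication by \<open>K F\<^sup>2 \<noteq> 0\<close>.

  In a chart, let \<open>\<beta> = b\<^sub>i y\<^sup>i\<close> be parallel, that is \<open>\<partial>\<^sub>j b\<^sub>i = G\<^sup>h\<^sub>i\<^sub>j b\<^sub>h\<close>. The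
  integrability condition of this system, contracted with \<open>y\<close>, is \<open>b\<^sub>h R\<^sup>h\<^sub>i = 0\<close>
  (\<open>parallel_form_annihilates_riemann_curv\<close>). For scalar curvature it reads
  \<open>K (F\<^sup>2 b\<^sub>i - y\<^sub>i \<beta>) = 0\<close> for all nonzero \<open>y\<close>. Suppose that \<open>b\<^sub>i \<noteq> 0\<close> at some point. In
  dimension at least 2 there is a nonzero \<open>y\<close> at this point with \<open>\<beta>(y) = 0\<close>
  (\<open>ex_nonzero_kernel_vector\<close>), and for this \<open>y\<close> the condition becomes \<open>K F\<^sup>2 b\<^sub>i = 0\<close>, which is
  impossible since \<open>K\<close> and \<open>F\<close> do not vanish on nonzero vectors.

  The integrability condition rests on two analytic facts. Second derivatives commute
  (\<open>second_derivative_symmetric\<close>); this is used for \<open>b\<^sub>i\<close> and, in the \<open>y\<close>-directions, for the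
  spray coefficients, which are smooth by Cramer's rule (\<open>smooth_spray_coeff\<close>). Euler's identity
  (\<open>euler_homogeneous\<close>) recovers the nonlinear connection and the spray from the Berwald
  connection. The passage from the manifold to a chart uses that the map \<open>induced\<close> takes nonzero
  coordinate vectors to nonzero tangent vectors and respects scaling
  (\<open>induced_in_slit_tangent_bundle\<close>, \<open>induced_scaleR\<close>).
\<close>

section \<open>Calculus of smooth functions\<close>

lemma Ck_on_cong:
  assumes "open S" and "\<And>x. x \<in> S \<Longrightarrow> f x = g x" and "Ck_on k f S"
  shows "Ck_on k g S"
  using assms(2,3)
proof (induction k arbitrary: f g)
  case 0
  then show ?case by (auto cong: continuous_on_cong)
next
  case (Suc k)
  have diff: "\<And>x. x \<in> S \<Longrightarrow> f differentiable (at x)"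
    and step: "\<And>v. Ck_on k (\<lambda>x. frechet_derivative f (at x) v) S"
    using Suc.prems by auto
  have eq: "frechet_derivative f (at x) = frechet_derivative g (at x)" if "x \<in> S" for x
    using frechet_derivative_transform_within_open[OF diff \<open>open S\<close>] that Suc.prems(1) by blast
  have "g differentiable (at x)" if "x \<in> S" for x
    using diff[OF that] has_derivative_transform_within_open[OF _ \<open>open S\<close> that] Suc.prems(1)
    unfolding differentiable_def by meson
  moreover have "Ck_on k (\<lambda>x. frechet_derivative g (at x) v) S" for v
    by (rule Suc.IH[OF _ step]) (simp add: eq)
  ultimately show ?case by simp
qed

text \<open>Differentiability is part of every level of the recursion except the lowest, which asks for
  continuity only; so the hierarchy is decreasing because differentiable maps are continuous.\<close>

lemma Ck_on_SucD: "Ck_on (Suc k) f S \<Longrightarrow> Ck_on k f S"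
proof (induction k arbitrary: f)
  case 0
  then show ?case
    by (auto intro!: continuous_at_imp_continuous_on differentiable_imp_continuous_within)
next
  case (Suc k)
  then show ?case by (metis Ck_on.simps(2))
qed

lemma Ck_on_const: "Ck_on k (\<lambda>x. c) S"
  by (induction k arbitrary: c) auto

lemma Ck_on_bounded_linear:
  assumes "bounded_linear f"
  shows "Ck_on k f S"
proof (cases k)
  case 0
  then show ?thesis using assms by (simp add: linear_continuous_on)
next
  case (Suc m)
  have "frechet_derivative f (at x) = f" for x
    using frechet_derivative_at[OF bounded_linear_imp_has_derivative[OF assms]] by simp
  then show ?thesis
    using Suc bounded_linear_imp_differentiable[OF assms] by (simp add: Ck_on_const)
qed

lemma frechet_derivative_add:
  assumes "f differentiable (at x)" "g differentiable (at x)"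
  shows "frechet_derivative (\<lambda>x. f x + g x) (at x) v =
    frechet_derivative f (at x) v + frechet_derivative g (at x) v"
  using fun_cong[OF frechet_derivative_at[OF has_derivative_add[OF
        assms[unfolded frechet_derivative_works]]], of v] by simp

lemma frechet_derivative_mult:
  fixes f g :: "'e::real_normed_vector \<Rightarrow> real"
  assumes "f differentiable (at x)" "g differentiable (at x)"
  shows "frechet_derivative (\<lambda>x. f x * g x) (at x) v =
    f x * frechet_derivative g (at x) v + frechet_derivative f (at x) v * g x"
  using fun_cong[OF frechet_derivative_at[OF has_derivative_mult[OF
        assms[unfolded frechet_derivative_works]]], of v] by simp

lemma frechet_derivative_sum:
  assumes "\<And>i. i \<in> I \<Longrightarrow> f i differentiable (at x)"
  shows "frechet_derivative (\<lambda>x. \<Sum>i\<in>I. f i x) (at x) v =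
    (\<Sum>i\<in>I. frechet_derivative (f i) (at x) v)"
proof -
  have "((\<lambda>x. \<Sum>i\<in>I. f i x) has_derivative (\<lambda>v. \<Sum>i\<in>I. frechet_derivative (f i) (at x) v)) (at x)"
    using assms by (intro has_derivative_sum) (simp add: frechet_derivative_works)
  from frechet_derivative_at[OF this] show ?thesis by (metis (mono_tags, lifting))
qed

lemma frechet_derivative_inverse:
  fixes f :: "'e::real_normed_vector \<Rightarrow> real"
  assumes "f differentiable (at x)" "f x \<noteq> 0"
  shows "frechet_derivative (\<lambda>x. inverse (f x)) (at x) v =
    - (inverse (f x) * (frechet_derivative f (at x) v * inverse (f x)))"
  using fun_cong[OF frechet_derivative_at[OF Deriv.has_derivative_inverse[OF assms(2)
        assms(1)[unfolded frechet_derivative_works]]], of v] by simp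

lemma Ck_on_add:
  assumes "open S" "Ck_on k f S" "Ck_on k g S"
  shows "Ck_on k (\<lambda>x. f x + g x) S"
  using assms(2,3)
proof (induction k arbitrary: f g)
  case 0
  then show ?case by (auto intro: continuous_intros)
next
  case (Suc k)
  have "Ck_on k (\<lambda>x. frechet_derivative (\<lambda>x. f x + g x) (at x) v) S" for v
    by (rule Ck_on_cong[OF \<open>open S\<close> _ Suc.IH[of "\<lambda>x. frechet_derivative f (at x) v"
            "\<lambda>x. frechet_derivative g (at x) v"]])
      (use Suc.prems in \<open>auto simp: frechet_derivative_add\<close>)
  then show ?case using Suc.prems by auto
qed

lemma Ck_on_mult:
  fixes f g :: "'e::euclidean_space \<Rightarrow> real"
  assumes "open S" "Ck_on k f S" "Ck_on k g S"
  shows "Ck_on k (\<lambda>x. f x * g x) S"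
  using assms(2,3)
proof (induction k arbitrary: f g)
  case 0
  then show ?case by (auto intro: continuous_intros)
next
  case (Suc k)
  have "Ck_on k (\<lambda>x. f x * frechet_derivative g (at x) v + frechet_derivative f (at x) v * g x) S"
    for v
    using Suc.prems Ck_on_SucD by (intro Ck_on_add[OF \<open>open S\<close>] Suc.IH) auto
  then have "Ck_on k (\<lambda>x. frechet_derivative (\<lambda>x. f x * g x) (at x) v) S" for v
    by (rule Ck_on_cong[OF \<open>open S\<close>, rotated])
      (use Suc.prems in \<open>auto simp: frechet_derivative_mult\<close>)
  then show ?case using Suc.prems by auto
qed

lemma Ck_on_inverse:
  fixes f :: "'e::euclidean_space \<Rightarrow> real"
  assumes "open S" "\<And>x. x \<in> S \<Longrightarrow> f x \<noteq> 0" "Ck_on k f S"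
  shows "Ck_on k (\<lambda>x. inverse (f x)) S"
  using assms(3)
proof (induction k)
  case 0
  then show ?case using assms(2) by (auto intro: continuous_intros)
next
  case (Suc k)
  have "Ck_on k (\<lambda>x. (- 1) * (inverse (f x) * (frechet_derivative f (at x) v * inverse (f x)))) S"
    for v
    using Suc Ck_on_SucD by (intro Ck_on_mult[OF \<open>open S\<close>] Ck_on_const) auto
  then have "Ck_on k (\<lambda>x. frechet_derivative (\<lambda>x. inverse (f x)) (at x) v) S" for v
    by (rule Ck_on_cong[OF \<open>open S\<close>, rotated])
      (use Suc.prems assms(2) in \<open>auto simp: frechet_derivative_inverse\<close>)
  then show ?case using Suc.prems assms(2) by auto
qed

lemma smooth_on_imp_differentiable: "smooth_on f S \<Longrightarrow> x \<in> S \<Longrightarrow> f differentiable (at x)"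
  unfolding smooth_on_def by (metis Ck_on.simps(2))

lemma smooth_on_imp_continuous_on: "smooth_on f S \<Longrightarrow> continuous_on S f"
  unfolding smooth_on_def by (metis Ck_on.simps(1))

lemma smooth_on_derivative: "smooth_on f S \<Longrightarrow> smooth_on (\<lambda>x. frechet_derivative f (at x) v) S"
  unfolding smooth_on_def by (metis Ck_on.simps(2))

lemma smooth_on_cong:
  "open S \<Longrightarrow> (\<And>x. x \<in> S \<Longrightarrow> f x = g x) \<Longrightarrow> smooth_on f S \<Longrightarrow> smooth_on g S"
  unfolding smooth_on_def using Ck_on_cong by blast

lemma smooth_on_const: "smooth_on (\<lambda>x. c) S"
  by (simp add: smooth_on_def Ck_on_const)

lemma smooth_on_bounded_linear: "bounded_linear f \<Longrightarrow> smooth_on f S"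
  by (simp add: smooth_on_def Ck_on_bounded_linear)

lemma smooth_on_add: "open S \<Longrightarrow> smooth_on f S \<Longrightarrow> smooth_on g S \<Longrightarrow> smooth_on (\<lambda>x. f x + g x) S"
  by (simp add: smooth_on_def Ck_on_add)

context
  fixes S :: "'e::euclidean_space set"
  assumes S: "open S"
begin

lemma smooth_on_mult:
  fixes f g :: "'e \<Rightarrow> real"
  shows "smooth_on f S \<Longrightarrow> smooth_on g S \<Longrightarrow> smooth_on (\<lambda>x. f x * g x) S"
  using S by (simp add: smooth_on_def Ck_on_mult)

lemma smooth_on_diff:
  fixes f g :: "'e \<Rightarrow> real"
  assumes "smooth_on f S" "smooth_on g S"
  shows "smooth_on (\<lambda>x. f x - g x) S"
  using smooth_on_add[OF S assms(1) smooth_on_mult[OF smooth_on_const[of "- 1"] assms(2)]]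
  by simp

lemma smooth_on_divide:
  fixes f g :: "'e \<Rightarrow> real"
  assumes "smooth_on f S" "smooth_on g S" "\<And>x. x \<in> S \<Longrightarrow> g x \<noteq> 0"
  shows "smooth_on (\<lambda>x. f x / g x) S"
  using smooth_on_mult[OF assms(1), of "\<lambda>x. inverse (g x)"] Ck_on_inverse[OF S assms(3)] assms(2)
  unfolding divide_inverse by (auto simp: smooth_on_def)

lemma smooth_on_sum:
  fixes f :: "'i \<Rightarrow> 'e \<Rightarrow> 'f::real_normed_vector"
  assumes "\<And>i. i \<in> I \<Longrightarrow> smooth_on (f i) S"
  shows "smooth_on (\<lambda>x. \<Sum>i\<in>I. f i x) S"
  using assms by (induction I rule: infinite_finite_induct)
    (auto intro: smooth_on_const smooth_on_add[OF S])

lemma smooth_on_prod: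
  fixes f :: "'i \<Rightarrow> 'e \<Rightarrow> real"
  assumes "\<And>i. i \<in> I \<Longrightarrow> smooth_on (f i) S"
  shows "smooth_on (\<lambda>x. \<Prod>i\<in>I. f i x) S"
  using assms by (induction I rule: infinite_finite_induct)
    (auto intro: smooth_on_const smooth_on_mult)

lemma smooth_on_det:
  fixes a :: "'e \<Rightarrow> real ^ 'n ^ 'n"
  assumes "\<And>i j. smooth_on (\<lambda>x. a x $ i $ j) S"
  shows "smooth_on (\<lambda>x. det (a x)) S"
  unfolding det_def
  by (intro smooth_on_sum smooth_on_mult smooth_on_prod smooth_on_const assms)

text \<open>By Cramer's rule each component of \<open>a\<^sup>-\<^sup>1 r\<close> is a quotient of determinants,
  hence a rational function of the entries of \<open>a\<close> and \<open>r\<close>.\<close>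

lemma smooth_on_matrix_inv_mult:
  fixes a :: "'e \<Rightarrow> real ^ 'n ^ 'n" and r :: "'e \<Rightarrow> 'n \<Rightarrow> real"
  assumes a: "\<And>i j. smooth_on (\<lambda>x. a x $ i $ j) S" and "\<And>x. x \<in> S \<Longrightarrow> invertible (a x)"
    and r: "\<And>i. smooth_on (\<lambda>x. r x i) S"
  shows "smooth_on (\<lambda>x. \<Sum>l\<in>UNIV. matrix_inv (a x) $ i $ l * r x l) S"
proof -
  have det: "det (a x) \<noteq> 0" if "x \<in> S" for x
    using assms(2)[OF that] by (simp add: invertible_det_nz)
  define c where "c x = (\<chi> k j. if j = i then r x k else a x $ k $ j)" for x
  have eq: "det (c x) / det (a x) = (\<Sum>l\<in>UNIV. matrix_inv (a x) $ i $ l * r x l)"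
    if "x \<in> S" for x
  proof -
    have "a x ** matrix_inv (a x) = mat 1"
      using assms(2)[OF that] unfolding invertible_def matrix_inv_def by (metis (mono_tags, lifting) someI_ex)
    then have "a x *v (matrix_inv (a x) *v (\<chi> l. r x l)) = (\<chi> l. r x l)"
      by (simp add: matrix_vector_mul_assoc)
    then have "matrix_inv (a x) *v (\<chi> l. r x l) = (\<chi> k. det (\<chi> i j. if j = k then (\<chi> l. r x l) $ i else a x $ i $ j) / det (a x))"
      using cramer[OF det[OF that]] by blast
    then show ?thesis
      by (simp add: vec_eq_iff matrix_vector_mult_def c_def cong: if_cong)
  qed
  have "smooth_on (\<lambda>x. c x $ k $ j) S" for k j
    by (cases "j = i") (simp_all add: c_def a r)
  then have "smooth_on (\<lambda>x. det (c x) / det (a x)) S"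
    by (intro smooth_on_divide smooth_on_det a det)
  then show ?thesis by (rule smooth_on_cong[OF S, rotated]) (rule eq)
qed

end

section \<open>Symmetry of second derivatives\<close>

lemma has_real_derivative_along_line:
  fixes f :: "'e::real_normed_vector \<Rightarrow> real"
  assumes "f differentiable (at (p + t *\<^sub>R u))"
  shows "((\<lambda>t. f (p + t *\<^sub>R u)) has_real_derivative frechet_derivative f (at (p + t *\<^sub>R u)) u) (at t)"
proof -
  have f: "(f has_derivative frechet_derivative f (at (p + t *\<^sub>R u))) (at (p + t *\<^sub>R u))"
    using assms by (simp add: frechet_derivative_works)
  have "((\<lambda>t. p + t *\<^sub>R u) has_derivative (\<lambda>t. t *\<^sub>R u)) (at t)"
    by (auto intro!: derivative_eq_intros)
  from has_derivative_compose[OF this f]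
  have "((\<lambda>t. f (p + t *\<^sub>R u)) has_derivative
    (\<lambda>s. frechet_derivative f (at (p + t *\<^sub>R u)) (s *\<^sub>R u))) (at t)" .
  moreover have "frechet_derivative f (at (p + t *\<^sub>R u)) (s *\<^sub>R u) =
      frechet_derivative f (at (p + t *\<^sub>R u)) u * s" for s
    using linear_frechet_derivative[OF assms] by (simp add: linear_cmul)
  ultimately show ?thesis by (simp add: has_field_derivative_def)
qed

text \<open>Applying the mean value theorem first to \<open>s \<mapsto> f (x + s u + h v) - f (x + s u)\<close> and then to
  the derivative of \<open>f\<close> along \<open>u\<close> turns the second difference of \<open>f\<close> over a
  parallelogram into a second derivative at one of its points.\<close>

lemma second_difference:
  fixes f :: "'e::euclidean_space \<Rightarrow> real"
  assumes "h > 0"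
    and S: "\<And>s t. s \<in> {0..h} \<Longrightarrow> t \<in> {0..h} \<Longrightarrow> x + s *\<^sub>R u + t *\<^sub>R v \<in> S"
    and f: "\<And>z. z \<in> S \<Longrightarrow> f differentiable (at z)"
    and f': "\<And>z. z \<in> S \<Longrightarrow> (\<lambda>z. frechet_derivative f (at z) u) differentiable (at z)"
  obtains s t where "s \<in> {0..h}" "t \<in> {0..h}"
    "f (x + h *\<^sub>R u + h *\<^sub>R v) - f (x + h *\<^sub>R u) - f (x + h *\<^sub>R v) + f x =
      h * h * frechet_derivative (\<lambda>z. frechet_derivative f (at z) u) (at (x + s *\<^sub>R u + t *\<^sub>R v)) v"
proof -
  let ?d = "\<lambda>z. frechet_derivative f (at z) u"
  have "((\<lambda>s. f ((x + h *\<^sub>R v) + s *\<^sub>R u) - f (x + s *\<^sub>R u)) has_real_derivative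
      ?d ((x + h *\<^sub>R v) + s *\<^sub>R u) - ?d (x + s *\<^sub>R u)) (at s)" if "0 \<le> s" "s \<le> h" for s
    using S[of s h] S[of s 0] that \<open>h > 0\<close>
    by (intro DERIV_diff has_real_derivative_along_line f) (auto simp: algebra_simps)
  from MVT2[OF \<open>h > 0\<close> this] obtain s where s: "0 < s" "s < h"
    "f ((x + h *\<^sub>R v) + h *\<^sub>R u) - f (x + h *\<^sub>R u) - (f ((x + h *\<^sub>R v) + 0 *\<^sub>R u) - f (x + 0 *\<^sub>R u)) =
     (h - 0) * (?d ((x + h *\<^sub>R v) + s *\<^sub>R u) - ?d (x + s *\<^sub>R u))"
    by blast
  have "((\<lambda>t. ?d ((x + s *\<^sub>R u) + t *\<^sub>R v)) has_real_derivative
      frechet_derivative ?d (at ((x + s *\<^sub>R u) + t *\<^sub>R v)) v) (at t)" if "0 \<le> t" "t \<le> h" for t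
    using S[of s t] that s by (intro has_real_derivative_along_line f') auto
  from MVT2[OF \<open>h > 0\<close> this] obtain t where t: "0 < t" "t < h"
    "?d ((x + s *\<^sub>R u) + h *\<^sub>R v) - ?d ((x + s *\<^sub>R u) + 0 *\<^sub>R v) =
     (h - 0) * frechet_derivative ?d (at ((x + s *\<^sub>R u) + t *\<^sub>R v)) v"
    by blast
  show ?thesis
    using that[of s t] s t by (auto simp: algebra_simps)
qed

text \<open>The second difference over the parallelogram spanned by \<open>h u\<close> and \<open>h v\<close> does not depend on
  the order of \<open>u\<close> and \<open>v\<close>. Hence the two mixed derivatives take a common value at points of
  an arbitrarily small parallelogram, and by continuity they agree at its vertex.\<close>

lemma second_derivative_symmetric:
  fixes f :: "'e::euclidean_space \<Rightarrow> real"
  assumes "open S" "x \<in> S" "smooth_on f S"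
  shows "frechet_derivative (\<lambda>z. frechet_derivative f (at z) u) (at x) v =
    frechet_derivative (\<lambda>z. frechet_derivative f (at z) v) (at x) u"
proof -
  let ?D = "\<lambda>u v x. frechet_derivative (\<lambda>z. frechet_derivative f (at z) u) (at x) v"
  have close: "\<bar>?D u v x - ?D v u x\<bar> \<le> e" if "e > 0" for e
  proof -
    have cont: "\<forall>\<^sub>F z in at x. dist (?D u v z) (?D u v x) < e / 2" for u v
    proof -
      have "continuous_on S (?D u v)"
        by (intro smooth_on_imp_continuous_on smooth_on_derivative assms)
      then have "(?D u v \<longlongrightarrow> ?D u v x) (at x)"
        using assms by (simp add: continuous_on_eq_continuous_at isCont_def)
      then show ?thesis by (rule tendstoD) (use that in simp)
    qed
    have "\<forall>\<^sub>F z in at x. z \<in> S \<and> dist (?D u v z) (?D u v x) < e / 2 \<and> dist (?D v u z) (?D v u x) < e / 2"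
      using cont[of u v] cont[of v u] eventually_at_topological[of "\<lambda>z. z \<in> S" x] assms(1,2)
      by (auto simp: eventually_conj_iff)
    then obtain d where d: "d > 0" and
      near: "\<And>z. z \<noteq> x \<Longrightarrow> dist z x < d \<Longrightarrow>
        z \<in> S \<and> dist (?D u v z) (?D u v x) < e / 2 \<and> dist (?D v u z) (?D v u x) < e / 2"
      by (auto simp: eventually_at)
    have near: "z \<in> S \<and> dist (?D u v z) (?D u v x) < e / 2 \<and> dist (?D v u z) (?D v u x) < e / 2"
      if "dist z x < d" for z
      using near[of z] that assms(2) \<open>e > 0\<close> by (cases "z = x") auto
    \<comment> \<open>With this \<open>h\<close> the parallelogram lies in the ball of radius \<open>d\<close> around \<open>x\<close>; the
      summand 1 keeps the denominator nonzero if \<open>u = v = 0\<close>.\<close>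
    define h where "h = d / (2 * (norm u + norm v + 1))"
    have h: "h > 0" using d by (simp add: h_def add_nonneg_pos)
    have "h * (norm u + norm v) < d"
    proof -
      have "h * (norm u + norm v) \<le> h * (norm u + norm v + 1)" using h by simp
      also have "\<dots> = d / 2" unfolding h_def using norm_ge_zero[of u] norm_ge_zero[of v]
        by (simp add: field_simps add_nonneg_eq_0_iff)
      finally show ?thesis using d by simp
    qed
    moreover have "dist (x + s *\<^sub>R u + t *\<^sub>R v) x \<le> h * (norm u + norm v)"
      if "s \<in> {0..h}" "t \<in> {0..h}" for s t
    proof -
      have "dist (x + s *\<^sub>R u + t *\<^sub>R v) x = norm (s *\<^sub>R u + t *\<^sub>R v)" by (simp add: dist_norm add.assoc)
      also have "\<dots> \<le> s * norm u + t * norm v"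
        using norm_triangle_ineq[of "s *\<^sub>R u" "t *\<^sub>R v"] that by simp
      also have "\<dots> \<le> h * norm u + h * norm v"
        using that by (intro add_mono mult_right_mono) auto
      finally show ?thesis by (simp add: algebra_simps)
    qed
    ultimately have box: "dist (x + s *\<^sub>R u + t *\<^sub>R v) x < d" if "s \<in> {0..h}" "t \<in> {0..h}" for s t
      using that by (meson le_less_trans)
    have diff: "f differentiable (at z)" "(\<lambda>z. frechet_derivative f (at z) w) differentiable (at z)"
      if "z \<in> S" for z w
      using assms(3) smooth_on_derivative smooth_on_imp_differentiable that by blast+
    have in1: "x + s *\<^sub>R u + t *\<^sub>R v \<in> S" if "s \<in> {0..h}" "t \<in> {0..h}" for s t
      using near[OF box[OF that]] by blast
    obtain s t where st: "s \<in> {0..h}" "t \<in> {0..h}"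
      "f (x + h *\<^sub>R u + h *\<^sub>R v) - f (x + h *\<^sub>R u) - f (x + h *\<^sub>R v) + f x =
       h * h * ?D u v (x + s *\<^sub>R u + t *\<^sub>R v)"
      using second_difference[OF h, of x u v S f] in1 diff by blast
    obtain s' t' where st': "s' \<in> {0..h}" "t' \<in> {0..h}"
      "f (x + h *\<^sub>R v + h *\<^sub>R u) - f (x + h *\<^sub>R v) - f (x + h *\<^sub>R u) + f x =
       h * h * ?D v u (x + s' *\<^sub>R v + t' *\<^sub>R u)"
    proof (rule second_difference[OF h, of x v u S f])
      show "x + s *\<^sub>R v + t *\<^sub>R u \<in> S" if "s \<in> {0..h}" "t \<in> {0..h}" for s t
        using in1[of t s] that by (simp add: add_ac)
    qed (use diff in blast)+
    have "h * h * ?D u v (x + s *\<^sub>R u + t *\<^sub>R v) = h * h * ?D v u (x + s' *\<^sub>R v + t' *\<^sub>R u)"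
      using st(3) st'(3) by (simp add: algebra_simps)
    then have "?D u v (x + s *\<^sub>R u + t *\<^sub>R v) = ?D v u (x + t' *\<^sub>R u + s' *\<^sub>R v)"
      using h by (simp add: add_ac)
    moreover have "dist (?D u v (x + s *\<^sub>R u + t *\<^sub>R v)) (?D u v x) < e / 2"
      using near[OF box[OF st(1,2)]] by blast
    moreover have "dist (?D v u (x + t' *\<^sub>R u + s' *\<^sub>R v)) (?D v u x) < e / 2"
      using near[OF box[OF st'(2,1)]] by blast
    ultimately show ?thesis unfolding dist_real_def by linarith
  qed
  have "\<bar>?D u v x - ?D v u x\<bar> \<le> 0"
    by (rule field_le_epsilon) (use close in simp)
  then show ?thesis by simp
qed

section \<open>Positively homogeneous functions\<close>

text \<open>The factor \<open>t\<close> is positive and \<open>y\<close> nonzero, since the functions in question are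
  controlled on the slit bundle only and need not be symmetric under \<open>y \<mapsto> - y\<close>.\<close>

definition y_homogeneous ::
  "nat \<Rightarrow> ((real ^ 'n::finite) \<times> (real ^ 'n) \<Rightarrow> real) \<Rightarrow> (real ^ 'n) set \<Rightarrow> bool" where
  "y_homogeneous k f U \<longleftrightarrow> (\<forall>x\<in>U. \<forall>y. y \<noteq> 0 \<longrightarrow> (\<forall>t>0. f (x, t *\<^sub>R y) = t ^ k * f (x, y)))"

lemma y_homogeneousD:
  "y_homogeneous k f U \<Longrightarrow> x \<in> U \<Longrightarrow> y \<noteq> 0 \<Longrightarrow> t > 0 \<Longrightarrow> f (x, t *\<^sub>R y) = t ^ k * f (x, y)"
  by (simp add: y_homogeneous_def)

lemma open_Times_nonzero:
  fixes U :: "(real ^ 'n::finite) set"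
  shows "open U \<Longrightarrow> open (U \<times> (- {0 :: real ^ 'n}))"
  by (intro open_Times open_Compl closed_singleton)

lemma bounded_linear_fibre_coordinate:
  "bounded_linear (\<lambda>z :: (real ^ 'n::finite) \<times> (real ^ 'n). snd z $ i)"
  by (rule bounded_linear_compose[OF bounded_linear_vec_nth bounded_linear_snd])

lemma smooth_on_dx: "smooth_on f S \<Longrightarrow> smooth_on (dx i f) S"
  unfolding dx_def[abs_def] by (rule smooth_on_derivative)

lemma smooth_on_dy: "smooth_on f S \<Longrightarrow> smooth_on (dy i f) S"
  unfolding dy_def[abs_def] by (rule smooth_on_derivative)

lemma linear_fibre_expansion:
  fixes D :: "(real ^ 'n::finite) \<times> (real ^ 'n) \<Rightarrow> real"
  assumes "linear D"
  shows "D (0, y) = (\<Sum>i\<in>UNIV. y $ i * D (0, axis i 1))"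
proof -
  have lin: "linear (\<lambda>y. D (0, y))"
    using linear_add[OF assms, of "(0, _)" "(0, _)"] linear_cmul[OF assms, of _ "(0, _)"]
    by (intro linearI) simp_all
  have "D (0, y) = D (0, \<Sum>i\<in>UNIV. y $ i *\<^sub>R axis i 1)"
    using basis_expansion[of y] by (simp add: scalar_mult_eq_scaleR)
  also have "\<dots> = (\<Sum>i\<in>UNIV. y $ i * D (0, axis i 1))"
    using linear_sum[OF lin, of "\<lambda>i. y $ i *\<^sub>R axis i 1"] linear_cmul[OF lin] by simp
  finally show ?thesis .
qed

text \<open>Chain rule for \<open>f \<circ> m = t\<^sup>k f\<close>, where \<open>m (x, y) = (x, t y)\<close>. It contains the two facts
  below: a derivative in the direction of \<open>x\<close> keeps the degree of homogeneity, and one in the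
  direction of \<open>y\<close> lowers it by one.\<close>

lemma frechet_derivative_fibre_scaling:
  fixes f :: "(real ^ 'n::finite) \<times> (real ^ 'n) \<Rightarrow> real"
  assumes "open U" "smooth_on f (U \<times> (- {0}))" "y_homogeneous k f U" "x \<in> U" "y \<noteq> 0" "t > 0"
  shows "frechet_derivative f (at (x, t *\<^sub>R y)) (v, t *\<^sub>R w) = t ^ k * frechet_derivative f (at (x, y)) (v, w)"
proof -
  let ?m = "\<lambda>z :: (real ^ 'n) \<times> (real ^ 'n). (fst z, t *\<^sub>R snd z)"
  have m: "bounded_linear ?m"
    by (intro bounded_linear_Pair bounded_linear_fst bounded_linear_scaleR_right
        bounded_linear_compose[OF bounded_linear_scaleR_right bounded_linear_snd])
  have D: "f differentiable (at (x, y))" "f differentiable (at (x, t *\<^sub>R y))"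
    using assms by (auto intro!: smooth_on_imp_differentiable[OF assms(2)])
  have "((\<lambda>z. f (?m z)) has_derivative (\<lambda>h. frechet_derivative f (at (x, t *\<^sub>R y)) (?m h))) (at (x, y))"
    using has_derivative_compose[OF bounded_linear_imp_has_derivative[OF m], of f _ "(x, y)"] D(2)
    by (simp add: frechet_derivative_works)
  moreover have "((\<lambda>z. f (?m z)) has_derivative (\<lambda>h. t ^ k * frechet_derivative f (at (x, y)) h)) (at (x, y))"
  proof (rule has_derivative_transform_within_open[OF _ open_Times_nonzero[OF assms(1)]])
    show "((\<lambda>z. t ^ k * f z) has_derivative (\<lambda>h. t ^ k * frechet_derivative f (at (x, y)) h)) (at (x, y))"
      using D(1) by (intro has_derivative_mult_right) (simp add: frechet_derivative_works)
    show "t ^ k * f z = f (?m z)" if "z \<in> U \<times> (- {0})" for z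
      using that y_homogeneousD[OF assms(3), of "fst z" "snd z" t] assms(6) by (cases z) simp
  qed (use assms in auto)
  ultimately have "(\<lambda>h. frechet_derivative f (at (x, t *\<^sub>R y)) (?m h)) =
      (\<lambda>h. t ^ k * frechet_derivative f (at (x, y)) h)"
    by (rule has_derivative_unique)
  from fun_cong[OF this, of "(v, w)"] show ?thesis by simp
qed

lemma y_homogeneous_dx:
  assumes "open U" "smooth_on f (U \<times> (- {0}))" "y_homogeneous k f U"
  shows "y_homogeneous k (dx i f) U"
  using frechet_derivative_fibre_scaling[OF assms, where w = 0] by (simp add: y_homogeneous_def dx_def)

lemma y_homogeneous_dy:
  fixes f :: "(real ^ 'n::finite) \<times> (real ^ 'n) \<Rightarrow> real"
  assumes "open U" "smooth_on f (U \<times> (- {0}))" "y_homogeneous (Suc k) f U"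
  shows "y_homogeneous k (dy i f) U"
  unfolding y_homogeneous_def
proof (intro ballI allI impI)
  fix x y :: "real ^ 'n" and t :: real assume *: "x \<in> U" "y \<noteq> 0" "t > 0"
  have "linear (frechet_derivative f (at (x, t *\<^sub>R y)))"
    using * by (intro linear_frechet_derivative smooth_on_imp_differentiable[OF assms(2)]) auto
  from linear_cmul[OF this, of t "(0, axis i 1)"]
  have "frechet_derivative f (at (x, t *\<^sub>R y)) (0, t *\<^sub>R axis i 1) = t * dy i f (x, t *\<^sub>R y)"
    by (simp add: dy_def)
  from trans[OF this[symmetric] frechet_derivative_fibre_scaling[OF assms *]]
  have "t * dy i f (x, t *\<^sub>R y) = t * (t ^ k * dy i f (x, y))"
    by (simp only: dy_def power_Suc mult.assoc)
  then show "dy i f (x, t *\<^sub>R y) = t ^ k * dy i f (x, y)" using * by simp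
qed

text \<open>Both sides are the derivative of \<open>t \<mapsto> f (x, t y)\<close> at \<open>t = 1\<close>.\<close>

lemma euler_homogeneous:
  assumes "open U" "smooth_on f (U \<times> (- {0}))" "y_homogeneous k f U" "x \<in> U" "y \<noteq> 0"
  shows "(\<Sum>i\<in>UNIV. y $ i * dy i f (x, y)) = of_nat k * f (x, y)"
proof -
  have D: "f differentiable (at (x, y))"
    using assms by (auto intro!: smooth_on_imp_differentiable[OF assms(2)])
  have "((\<lambda>t. f ((x, 0) + t *\<^sub>R (0, y))) has_real_derivative
      frechet_derivative f (at ((x, 0) + 1 *\<^sub>R (0, y))) (0, y)) (at 1)"
    by (rule has_real_derivative_along_line) (use D in simp)
  moreover have "((\<lambda>t. f ((x, 0) + t *\<^sub>R (0, y))) has_real_derivative of_nat k * f (x, y)) (at 1)"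
  proof (rule has_field_derivative_transform_within_open[of "\<lambda>t. t ^ k * f (x, y)" _ _ "{0<..}"])
    show "((\<lambda>t. t ^ k * f (x, y)) has_real_derivative of_nat k * f (x, y)) (at 1)"
      by (auto intro!: derivative_eq_intros)
  qed (use assms in \<open>auto simp: y_homogeneousD[OF assms(3)]\<close>)
  ultimately have "frechet_derivative f (at (x, y)) (0, y) = of_nat k * f (x, y)"
    using DERIV_unique by fastforce
  then show ?thesis
    using linear_fibre_expansion[OF linear_frechet_derivative[OF D], of y] by (simp add: dy_def)
qed

section \<open>Spray and Berwald connection in coordinates\<close>

text \<open>The local expression \<open>L\<close> of a Finsler metric in one chart with image \<open>U\<close>. The rank condition
  appears as invertibility, the form in which Cramer's rule makes the spray smooth.\<close>

locale finsler_in_coordinates =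
  fixes U :: "(real ^ 'n::finite) set" and L :: "(real ^ 'n) \<times> (real ^ 'n) \<Rightarrow> real"
  assumes open_U: "open U"
    and smooth_L: "smooth_on L (U \<times> (- {0}))"
    and homogeneous_L: "y_homogeneous 1 L U"
    and invertible_metric: "z \<in> U \<times> (- {0}) \<Longrightarrow> invertible (metric_tensor L z)"
begin

abbreviation "slit \<equiv> U \<times> (- {0 :: real ^ 'n})"

abbreviation "G \<equiv> spray_coeff L"
abbreviation "N \<equiv> nonlinear_conn L"

lemma open_slit: "open slit"
  using open_U by (rule open_Times_nonzero)

lemma smooth_square: "smooth_on (\<lambda>w. (L w)\<^sup>2) slit"
  unfolding power2_eq_square by (intro smooth_on_mult open_slit smooth_L)

lemma smooth_half_square: "smooth_on (\<lambda>w. (L w)\<^sup>2 / 2) slit"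
  by (intro smooth_on_divide open_slit smooth_square smooth_on_const) simp

lemma homogeneous_square: "y_homogeneous 2 (\<lambda>w. (L w)\<^sup>2) U"
  using homogeneous_L by (simp add: y_homogeneous_def power_mult_distrib)

lemma homogeneous_half_square: "y_homogeneous 2 (\<lambda>w. (L w)\<^sup>2 / 2) U"
  using homogeneous_square by (simp add: y_homogeneous_def)

lemma smooth_spray_coeff: "smooth_on (G i) slit"
proof -
  define r where "r z l = (\<Sum>k\<in>UNIV. snd z $ k * dx k (dy l (\<lambda>w. (L w)\<^sup>2)) z) - dx l (\<lambda>w. (L w)\<^sup>2) z" for z l
  have y: "smooth_on (\<lambda>z. snd z $ k) slit" for k
    by (rule smooth_on_bounded_linear[OF bounded_linear_fibre_coordinate])
  have r: "smooth_on (\<lambda>z. r z l) slit" for l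
    unfolding r_def
    by (intro smooth_on_diff smooth_on_sum smooth_on_mult open_slit smooth_on_dx smooth_on_dy smooth_square y)
  have "smooth_on (\<lambda>z. \<Sum>l\<in>UNIV. matrix_inv (metric_tensor L z) $ i $ l * r z l) slit"
    by (rule smooth_on_matrix_inv_mult[OF open_slit _ invertible_metric r])
      (simp add: metric_tensor_def smooth_on_dy smooth_half_square)
  then show ?thesis
    unfolding spray_coeff_def[abs_def] r_def[symmetric]
    by (intro smooth_on_mult open_slit smooth_on_const)
qed

text \<open>The metric tensor has degree 0, being a second \<open>y\<close>-derivative of a function of degree 2, and
  both terms in the bracket defining the spray coefficients have degree 2.\<close>

lemma homogeneous_spray_coeff: "y_homogeneous 2 (G i) U"
  unfolding y_homogeneous_def
proof (intro ballI allI impI)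
  fix x y :: "real ^ 'n" and t :: real assume *: "x \<in> U" "y \<noteq> 0" "t > 0"
  have [simp]: "metric_tensor L (x, t *\<^sub>R y) = metric_tensor L (x, y)"
  proof -
    have "y_homogeneous 0 (dy i (dy j (\<lambda>w. (L w)\<^sup>2 / 2))) U" for i j
      using homogeneous_half_square
      by (intro y_homogeneous_dy open_U smooth_on_dy smooth_half_square) (simp add: numeral_2_eq_2)
    from y_homogeneousD[OF this *] show ?thesis by (simp add: metric_tensor_def)
  qed
  have 1: "dx k (dy l (\<lambda>w. (L w)\<^sup>2)) (x, t *\<^sub>R y) = t * dx k (dy l (\<lambda>w. (L w)\<^sup>2)) (x, y)" for k l
  proof -
    have "y_homogeneous 1 (dx k (dy l (\<lambda>w. (L w)\<^sup>2))) U"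
      using homogeneous_square
      by (intro y_homogeneous_dx y_homogeneous_dy open_U smooth_on_dy smooth_square) (simp add: numeral_2_eq_2)
    from y_homogeneousD[OF this *] show ?thesis by simp
  qed
  have 2: "dx l (\<lambda>w. (L w)\<^sup>2) (x, t *\<^sub>R y) = t * (t * dx l (\<lambda>w. (L w)\<^sup>2) (x, y))" for l
    using y_homogeneousD[OF y_homogeneous_dx[OF open_U smooth_square homogeneous_square] *, of l]
    by (simp add: power2_eq_square[of t] mult.assoc)
  have "G i (x, t *\<^sub>R y) = t * (t * G i (x, y))"
    by (simp add: spray_coeff_def 1 2 sum_distrib_left algebra_simps sum_subtractf)
  then show "G i (x, t *\<^sub>R y) = t\<^sup>2 * G i (x, y)"
    by (simp add: power2_eq_square)
qed

lemma smooth_nonlinear_conn: "smooth_on (N h j) slit"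
  unfolding nonlinear_conn_def by (rule smooth_on_dy[OF smooth_spray_coeff])

lemma homogeneous_nonlinear_conn: "y_homogeneous 1 (N h j) U"
  unfolding nonlinear_conn_def
  using homogeneous_spray_coeff by (intro y_homogeneous_dy open_U smooth_spray_coeff) (simp add: numeral_2_eq_2)

lemma berwald_conn_symmetric: "z \<in> slit \<Longrightarrow> berwald_conn L h i j z = berwald_conn L h j i z"
  unfolding berwald_conn_def nonlinear_conn_def dy_def[abs_def]
  by (rule second_derivative_symmetric[OF open_slit _ smooth_spray_coeff])

lemma berwald_conn_contract:
  "x \<in> U \<Longrightarrow> y \<noteq> 0 \<Longrightarrow> (\<Sum>i\<in>UNIV. y $ i * berwald_conn L h i j (x, y)) = N h j (x, y)"
  using euler_homogeneous[OF open_U smooth_nonlinear_conn homogeneous_nonlinear_conn]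
  by (simp add: berwald_conn_def)

lemma nonlinear_conn_contract:
  "x \<in> U \<Longrightarrow> y \<noteq> 0 \<Longrightarrow> (\<Sum>j\<in>UNIV. y $ j * N h j (x, y)) = 2 * G h (x, y)"
  using euler_homogeneous[OF open_U smooth_spray_coeff homogeneous_spray_coeff]
  by (simp add: nonlinear_conn_def)

end

section \<open>The curvature annihilates parallel 1-forms\<close>

lemma dx_cong:
  assumes "f differentiable (at z)" "open S" "z \<in> S" "\<And>w. w \<in> S \<Longrightarrow> f w = g w"
  shows "dx k f z = dx k g z"
  unfolding dx_def using frechet_derivative_transform_within_open[OF assms] by simp

lemma dx_mult:
  "f differentiable (at z) \<Longrightarrow> g differentiable (at z) \<Longrightarrow>
    dx k (\<lambda>z. f z * g z) z = f z * dx k g z + dx k f z * g z"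
  unfolding dx_def by (rule frechet_derivative_mult)

lemma dx_sum:
  "(\<And>i. i \<in> I \<Longrightarrow> f i differentiable (at z)) \<Longrightarrow>
    dx k (\<lambda>z. \<Sum>i\<in>I. f i z) z = (\<Sum>i\<in>I. dx k (f i) z)"
  unfolding dx_def by (rule frechet_derivative_sum)

lemma dx_fibre_coordinate [simp]: "dx k (\<lambda>z. snd z $ i) z = 0"
  unfolding dx_def
  using fun_cong[OF frechet_derivative_at[OF bounded_linear_imp_has_derivative[OF
        bounded_linear_fibre_coordinate[of i]]], of "(axis k 1, 0)" z] by simp

lemma has_derivative_base:
  fixes c :: "real ^ 'n::finite \<Rightarrow> real" and z :: "(real ^ 'n) \<times> (real ^ 'n)"
  assumes "c differentiable (at (fst z))"
  shows "((\<lambda>z. c (fst z)) has_derivative (\<lambda>h. frechet_derivative c (at (fst z)) (fst h))) (at z)"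
  using has_derivative_compose[OF bounded_linear_imp_has_derivative[OF bounded_linear_fst]] assms
  by (simp add: frechet_derivative_works)

lemma differentiable_base:
  fixes c :: "real ^ 'n::finite \<Rightarrow> real" and z :: "(real ^ 'n) \<times> (real ^ 'n)"
  shows "c differentiable (at (fst z)) \<Longrightarrow> (\<lambda>z. c (fst z)) differentiable (at z)"
  using has_derivative_base unfolding differentiable_def by blast

lemma dx_base:
  fixes c :: "real ^ 'n::finite \<Rightarrow> real" and z :: "(real ^ 'n) \<times> (real ^ 'n)"
  shows "c differentiable (at (fst z)) \<Longrightarrow>
    dx k (\<lambda>z. c (fst z)) z = frechet_derivative c (at (fst z)) (axis k 1)"
  using fun_cong[OF frechet_derivative_at[OF has_derivative_base], of c z "(axis k 1, 0)"]
  by (simp add: dx_def)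

context finsler_in_coordinates
begin

text \<open>The Ricci identity for a parallel 1-form, in the contraction that involves the Riemann
  curvature only. Write \<open>B\<^sub>i\<^sub>j = \<partial>\<^sub>j b\<^sub>i\<close> and \<open>C\<^sub>i\<^sub>j\<^sub>k = \<partial>\<^sub>k \<partial>\<^sub>j b\<^sub>i\<close>. Being parallel
  means \<open>B\<^sub>i\<^sub>j = G\<^sup>h\<^sub>i\<^sub>j b\<^sub>h\<close>, so \<open>B\<close> is symmetric. As \<open>N\<close> and \<open>G\<close> are homogeneous of
  degree 1 and 2, Euler's identity gives
  \<open>N\<^sup>h\<^sub>j b\<^sub>h = y\<^sup>i B\<^sub>i\<^sub>j\<close> and \<open>2 G\<^sup>h b\<^sub>h = y\<^sup>k y\<^sup>i B\<^sub>i\<^sub>k\<close>.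
  The right-hand sides depend on \<open>x\<close> through \<open>B\<close> alone, so differentiating both identities in
  \<open>x\<close> expresses \<open>b\<^sub>h \<partial>\<^sub>k N\<^sup>h\<^sub>j\<close> and \<open>b\<^sub>h \<partial>\<^sub>j G\<^sup>h\<close> by \<open>B\<close>, \<open>C\<close>, \<open>N\<close> and \<open>G\<close>. In
  \<open>b\<^sub>h R\<^sup>h\<^sub>j\<close> the terms with \<open>C\<close> then cancel because second derivatives commute, those with
  \<open>N\<close> because \<open>B\<close> is symmetric, and those with \<open>G\<close> are equal and opposite.\<close>

lemma parallel_form_annihilates_riemann_curv:
  assumes b: "\<And>i. smooth_on (b i) U"
    and parallel: "\<And>i j z. z \<in> slit \<Longrightarrow> horizontal_deriv L b i j z = 0"
    and z: "z \<in> slit"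
  shows "(\<Sum>h\<in>UNIV. b h (fst z) * riemann_curv L h j z) = 0"
proof -
  define B where "B i j x = frechet_derivative (b i) (at x) (axis j 1)" for i j x
  define C where "C i j k x = frechet_derivative (B i j) (at x) (axis k 1)" for i j k x
  have smooth_B: "smooth_on (B i j) U" for i j
    unfolding B_def[abs_def] by (rule smooth_on_derivative[OF b])
  have C_sym: "C i j k x = C i k j x" if "x \<in> U" for i j k x
    unfolding C_def B_def[abs_def] by (rule second_derivative_symmetric[OF open_U that b])
  have diff_b: "b i differentiable (at (fst w))" "B i j differentiable (at (fst w))"
    if "w \<in> slit" for i j w
    using that smooth_on_imp_differentiable[OF b] smooth_on_imp_differentiable[OF smooth_B] by auto
  have diff_base: "(\<lambda>z. b i (fst z)) differentiable (at w)" "(\<lambda>z. B i j (fst z)) differentiable (at w)"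
    if "w \<in> slit" for i j w
    using differentiable_base diff_b[OF that] by blast+
  have diff_G: "G i differentiable (at w)" "N i j differentiable (at w)" if "w \<in> slit" for i j w
    using that smooth_on_imp_differentiable smooth_spray_coeff smooth_nonlinear_conn by blast+
  have diff_y: "(\<lambda>z :: (real ^ 'n) \<times> (real ^ 'n). snd z $ i) differentiable (at w)" for i w
    by (rule bounded_linear_imp_differentiable[OF bounded_linear_fibre_coordinate])
  have Bw: "(\<Sum>h\<in>UNIV. berwald_conn L h i j w * b h (fst w)) = B i j (fst w)" if "w \<in> slit" for i j w
    using parallel[OF that, of i j] by (simp add: horizontal_deriv_def B_def)
  have B_sym: "B i j (fst w) = B j i (fst w)" if "w \<in> slit" for i j w
    using Bw[OF that, of i j] Bw[OF that, of j i] berwald_conn_symmetric[OF that] by simp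
  have N1: "(\<Sum>h\<in>UNIV. N h j w * b h (fst w)) = (\<Sum>i\<in>UNIV. snd w $ i * B i j (fst w))"
    if w: "w \<in> slit" for j w
  proof -
    have "N h j w = (\<Sum>i\<in>UNIV. snd w $ i * berwald_conn L h i j w)" for h
      using w berwald_conn_contract[of "fst w" "snd w" h j] by (cases w) simp
    then have "(\<Sum>h\<in>UNIV. N h j w * b h (fst w)) =
        (\<Sum>h\<in>UNIV. \<Sum>i\<in>UNIV. snd w $ i * (berwald_conn L h i j w * b h (fst w)))"
      by (simp add: sum_distrib_right mult.assoc)
    also have "\<dots> = (\<Sum>i\<in>UNIV. \<Sum>h\<in>UNIV. snd w $ i * (berwald_conn L h i j w * b h (fst w)))"
      by (rule sum.swap)
    finally show ?thesis by (simp add: sum_distrib_left[symmetric] Bw[OF w])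
  qed
  have G1: "(\<Sum>h\<in>UNIV. 2 * (G h w * b h (fst w))) = (\<Sum>k\<in>UNIV. snd w $ k * (\<Sum>i\<in>UNIV. snd w $ i * B i k (fst w)))"
    if w: "w \<in> slit" for w
  proof -
    have "2 * G h w = (\<Sum>k\<in>UNIV. snd w $ k * N h k w)" for h
      using w nonlinear_conn_contract[of "fst w" "snd w" h] by (cases w) simp
    then have "(\<Sum>h\<in>UNIV. 2 * (G h w * b h (fst w))) =
        (\<Sum>h\<in>UNIV. \<Sum>k\<in>UNIV. snd w $ k * (N h k w * b h (fst w)))"
      by (simp add: sum_distrib_right mult.assoc[symmetric])
    also have "\<dots> = (\<Sum>k\<in>UNIV. \<Sum>h\<in>UNIV. snd w $ k * (N h k w * b h (fst w)))"
      by (rule sum.swap)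
    finally show ?thesis by (simp add: sum_distrib_left[symmetric] N1[OF w])
  qed
  obtain x y where xy: "z = (x, y)" "x \<in> U" "y \<noteq> 0" using z by (cases z) auto
  have [simp]: "fst z = x" "snd z = y" by (simp_all add: xy)
  have dx_b: "dx k (\<lambda>w. b i (fst w)) z = B i k x" for i k
    using dx_base[OF diff_b(1)[OF z]] by (simp add: B_def)
  have dx_B: "dx k (\<lambda>w. B i j (fst w)) z = C i j k x" for i j k
    using dx_base[OF diff_b(2)[OF z]] by (simp add: C_def)
  \<comment> \<open>Derivatives in \<open>x\<close> of the two contracted identities.\<close>
  have dN: "(\<Sum>h\<in>UNIV. b h x * dx k (N h j) z) =
      (\<Sum>i\<in>UNIV. y $ i * C i j k x) - (\<Sum>h\<in>UNIV. N h j z * B h k x)" for k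
  proof -
    have "dx k (\<lambda>w. \<Sum>h\<in>UNIV. N h j w * b h (fst w)) z = dx k (\<lambda>w. \<Sum>i\<in>UNIV. snd w $ i * B i j (fst w)) z"
      by (rule dx_cong[OF _ open_slit z N1])
        (auto intro!: differentiable_sum differentiable_mult diff_G diff_base z)
    then show ?thesis
      using z by (simp add: dx_sum dx_mult differentiable_mult diff_G diff_base diff_y dx_b dx_B
          sum.distrib algebra_simps)
  qed
  have dG: "(\<Sum>h\<in>UNIV. b h x * (2 * dx j (G h) z)) =
      (\<Sum>k\<in>UNIV. y $ k * (\<Sum>i\<in>UNIV. y $ i * C i k j x)) - 2 * (\<Sum>h\<in>UNIV. G h z * B h j x)"
  proof -
    have "dx j (\<lambda>w. \<Sum>h\<in>UNIV. 2 * (G h w * b h (fst w))) z =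
        dx j (\<lambda>w. \<Sum>k\<in>UNIV. snd w $ k * (\<Sum>i\<in>UNIV. snd w $ i * B i k (fst w))) z"
      by (rule dx_cong[OF _ open_slit z G1])
        (auto intro!: differentiable_sum differentiable_mult diff_G diff_base z)
    moreover have "dx j (\<lambda>w. 2) z = 0" by (simp add: dx_def)
    ultimately show ?thesis
      using z by (simp add: dx_sum dx_mult differentiable_mult differentiable_sum diff_G diff_base
          diff_y dx_b dx_B sum.distrib
          sum_distrib_left algebra_simps)
  qed
  \<comment> \<open>The remaining three terms of the curvature, contracted with \<open>b\<close>.\<close>
  have T2: "(\<Sum>h\<in>UNIV. b h x * (\<Sum>k\<in>UNIV. y $ k * dx k (N h j) z)) =
      (\<Sum>k\<in>UNIV. y $ k * (\<Sum>i\<in>UNIV. y $ i * C i j k x)) - (\<Sum>k\<in>UNIV. y $ k * (\<Sum>h\<in>UNIV. N h j z * B h k x))"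
  proof -
    have "(\<Sum>h\<in>UNIV. b h x * (\<Sum>k\<in>UNIV. y $ k * dx k (N h j) z)) =
        (\<Sum>h\<in>UNIV. \<Sum>k\<in>UNIV. y $ k * (b h x * dx k (N h j) z))"
      by (simp add: sum_distrib_left mult.left_commute)
    also have "\<dots> = (\<Sum>k\<in>UNIV. \<Sum>h\<in>UNIV. y $ k * (b h x * dx k (N h j) z))"
      by (rule sum.swap)
    finally show ?thesis
      by (simp add: sum_distrib_left[symmetric] dN right_diff_distrib sum_subtractf)
  qed
  have T3: "(\<Sum>h\<in>UNIV. b h x * (\<Sum>k\<in>UNIV. G k z * berwald_conn L h k j z)) = (\<Sum>k\<in>UNIV. G k z * B k j x)"
  proof -
    have "(\<Sum>h\<in>UNIV. b h x * (\<Sum>k\<in>UNIV. G k z * berwald_conn L h k j z)) =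
        (\<Sum>h\<in>UNIV. \<Sum>k\<in>UNIV. G k z * (berwald_conn L h k j z * b h x))"
      by (simp add: sum_distrib_left mult_ac)
    also have "\<dots> = (\<Sum>k\<in>UNIV. \<Sum>h\<in>UNIV. G k z * (berwald_conn L h k j z * b h x))"
      by (rule sum.swap)
    finally show ?thesis
      using Bw[OF z] by (simp add: sum_distrib_left[symmetric])
  qed
  have T4: "(\<Sum>h\<in>UNIV. b h x * (\<Sum>k\<in>UNIV. N h k z * N k j z)) = (\<Sum>k\<in>UNIV. y $ k * (\<Sum>h\<in>UNIV. N h j z * B h k x))"
  proof -
    have "(\<Sum>h\<in>UNIV. b h x * (\<Sum>k\<in>UNIV. N h k z * N k j z)) =
        (\<Sum>h\<in>UNIV. \<Sum>k\<in>UNIV. N k j z * (N h k z * b h x))"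
      by (simp add: sum_distrib_left mult_ac)
    also have "\<dots> = (\<Sum>k\<in>UNIV. \<Sum>h\<in>UNIV. N k j z * (N h k z * b h x))"
      by (rule sum.swap)
    also have "\<dots> = (\<Sum>h\<in>UNIV. N h j z * (\<Sum>k\<in>UNIV. y $ k * B k h x))"
      using N1[OF z] by (simp add: sum_distrib_left[symmetric])
    also have "\<dots> = (\<Sum>h\<in>UNIV. \<Sum>k\<in>UNIV. y $ k * (N h j z * B h k x))"
      using B_sym[OF z] by (simp add: sum_distrib_left mult_ac)
    also have "\<dots> = (\<Sum>k\<in>UNIV. \<Sum>h\<in>UNIV. y $ k * (N h j z * B h k x))"
      by (rule sum.swap)
    finally show ?thesis by (simp add: sum_distrib_left)
  qed
  have "(\<Sum>h\<in>UNIV. b h (fst z) * riemann_curv L h j z) =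
      (\<Sum>h\<in>UNIV. b h x * (2 * dx j (G h) z)) - (\<Sum>h\<in>UNIV. b h x * (\<Sum>k\<in>UNIV. y $ k * dx k (N h j) z))
      + 2 * (\<Sum>h\<in>UNIV. b h x * (\<Sum>k\<in>UNIV. G k z * berwald_conn L h k j z))
      - (\<Sum>h\<in>UNIV. b h x * (\<Sum>k\<in>UNIV. N h k z * N k j z))"
    by (simp add: riemann_curv_def spray_def berwald_conn_def[symmetric] right_diff_distrib
        sum_subtractf sum_distrib_left[of 2] mult.left_commute[of 2])
  also have "\<dots> = 0"
    unfolding dG T2 T3 T4 using C_sym[OF xy(2), of _ _ j] by simp
  finally show ?thesis .
qed

end

section \<open>Tangent vectors in charts\<close>

lemma frechet_derivative_id_near:
  assumes "open S" "x \<in> S" "\<And>w. w \<in> S \<Longrightarrow> f w = w"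
  shows "frechet_derivative f (at x) = (\<lambda>v. v)"
  using frechet_derivative_transform_within_open[OF differentiable_ident assms(1,2), of f] assms(3)
  by simp

context
  fixes M :: "'a topology" and A :: "('a, 'n::finite) chart set"
  assumes manifold: "smooth_manifold M A"
begin

lemma chart:
  assumes "c \<in> A"
  shows inj_on_chart: "inj_on (snd c) (fst c)"
    and open_chart_image: "open (snd c ` fst c)"
    and open_chart_image_Int: "d \<in> A \<Longrightarrow> open (snd c ` (fst c \<inter> fst d))"
proof -
  have c: "is_chart M c" and charts: "\<And>d. d \<in> A \<Longrightarrow> openin M (fst d)"
    using manifold assms by (auto simp: smooth_manifold_def is_chart_def)
  have hom: "homeomorphic_map (subtopology M (fst c)) (top_of_set (snd c ` fst c)) (snd c)"
    and open_image: "open (snd c ` fst c)"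
    using c by (auto simp: is_chart_def)
  have "topspace (subtopology M (fst c)) = fst c"
    using openin_subset[OF charts[OF assms]] by auto
  then show "inj_on (snd c) (fst c)"
    using homeomorphic_imp_injective_map[OF hom] by simp
  show "open (snd c ` fst c)" by fact
  assume "d \<in> A"
  then have "openin (subtopology M (fst c)) (fst c \<inter> fst d)"
    using charts[of d] unfolding openin_subtopology by blast
  then have "openin (top_of_set (snd c ` fst c)) (snd c ` (fst c \<inter> fst d))"
    using homeomorphic_imp_open_map[OF hom] by (simp add: open_map_def)
  then show "open (snd c ` (fst c \<inter> fst d))"
    using open_image by (simp add: openin_open_eq)
qed

lemma transition_chart: "c \<in> A \<Longrightarrow> p \<in> fst c \<Longrightarrow> transition c d (snd c p) = snd d p"
  by (simp add: transition_def inv_into_f_f inj_on_chart)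

lemma differentiable_transition:
  assumes "c \<in> A" "d \<in> A" "p \<in> fst c" "p \<in> fst d"
  shows "transition c d differentiable (at (snd c p))"
proof -
  have "smooth_on (transition c d) (snd c ` (fst c \<inter> fst d))"
    using manifold assms by (auto simp: smooth_manifold_def smoothly_compatible_def)
  then show ?thesis using assms by (auto intro: smooth_on_imp_differentiable)
qed

lemma frechet_derivative_transition_self:
  assumes "c \<in> A" "p \<in> fst c"
  shows "frechet_derivative (transition c c) (at (snd c p)) = (\<lambda>v. v)"
  by (rule frechet_derivative_id_near[OF open_chart_image[OF assms(1)]])
    (use assms in \<open>auto simp: transition_chart\<close>)

text \<open>The chain rule for transition maps. It makes the components that \<open>induced\<close> assigns to the
  charts transform like those of a tangent vector.\<close>

lemma frechet_derivative_transition_compose: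
  assumes "c \<in> A" "d \<in> A" "e \<in> A" "p \<in> fst c" "p \<in> fst d" "p \<in> fst e"
  shows "frechet_derivative (transition c e) (at (snd c p)) v =
    frechet_derivative (transition d e) (at (snd d p)) (frechet_derivative (transition c d) (at (snd c p)) v)"
proof -
  have "frechet_derivative (transition c e) (at (snd c p)) =
      frechet_derivative (transition d e \<circ> transition c d) (at (snd c p))"
  proof (rule frechet_derivative_transform_within_open)
    show "transition c e differentiable (at (snd c p))"
      by (rule differentiable_transition) fact+
    show "open (snd c ` (fst c \<inter> fst d))"
      by (rule open_chart_image_Int) fact+
  qed (use assms in \<open>auto simp: transition_chart\<close>)
  also have "\<dots> = frechet_derivative (transition d e) (at (snd d p)) \<circ> frechet_derivative (transition c d) (at (snd c p))"
    using frechet_derivative_compose[of "transition c d" "snd c p" "transition d e"]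
      differentiable_transition[of c d p] differentiable_transition[of d e p]
      transition_chart[of c p d] assms by simp
  finally show ?thesis by simp
qed

lemma induced_chart:
  assumes "c \<in> A" "p \<in> fst c"
  shows "induced A c (snd c p, y) = (p, \<lambda>d. if d \<in> A \<and> p \<in> fst d
    then frechet_derivative (transition c d) (at (snd c p)) y else 0)"
  using assms by (simp add: induced_def inv_into_f_f inj_on_chart Let_def)

lemma induced_in_slit_tangent_bundle:
  assumes c: "c \<in> A" and z: "z \<in> slit_domain c"
  shows "induced A c z \<in> slit_tangent_bundle M A"
proof -
  obtain p y where p: "p \<in> fst c" "y \<noteq> 0" and z: "z = (snd c p, y)"
    using z by (auto simp: slit_domain_def)
  have "p \<in> topspace M"
    using manifold c p by (auto simp: smooth_manifold_def)
  moreover have "(\<lambda>d. if d \<in> A \<and> p \<in> fst d then frechet_derivative (transition c d) (at (snd c p)) y else 0) \<noteq> (\<lambda>_. 0)"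
  proof
    assume eq: "(\<lambda>d. if d \<in> A \<and> p \<in> fst d then frechet_derivative (transition c d) (at (snd c p)) y else 0) = (\<lambda>_. 0)"
    from fun_cong[OF eq, of c] show False
      using frechet_derivative_transition_self[OF c p(1)] c p by simp
  qed
  ultimately show ?thesis
    using c p(1)
    by (simp add: z induced_chart slit_tangent_bundle_def tangent_bundle_def)
      (blast intro: frechet_derivative_transition_compose)
qed

lemma induced_scaleR:
  assumes c: "c \<in> A" and x: "x \<in> snd c ` fst c"
  shows "induced A c (x, t *\<^sub>R y) = (fst (induced A c (x, y)), \<lambda>d. t *\<^sub>R snd (induced A c (x, y)) d)"
proof -
  obtain p where p: "p \<in> fst c" "x = snd c p" using x by auto
  have "frechet_derivative (transition c d) (at (snd c p)) (t *\<^sub>R y) =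
      t *\<^sub>R frechet_derivative (transition c d) (at (snd c p)) y" if "d \<in> A" "p \<in> fst d" for d
    using linear_frechet_derivative[OF differentiable_transition[OF c that(1) p(1) that(2)]]
    by (rule linear_cmul)
  then show ?thesis by (auto simp: p induced_chart c)
qed

text \<open>A tangent vector is determined by its components in a single chart, so a 1-form that does not
  vanish somewhere has a nonzero coefficient in a suitable chart.\<close>

lemma tangent_vector_eq_induced:
  assumes "(p, v) \<in> tangent_bundle M A" "c \<in> A" "p \<in> fst c"
  shows "(p, v) = induced A c (snd c p, v c)"
proof -
  have comp: "v d = frechet_derivative (transition c d) (at (snd c p)) (v c)"
    if "d \<in> A" "p \<in> fst d" for d
    using assms that unfolding tangent_bundle_def mem_Collect_eq prod.case by blast
  have zero: "v d = 0" if "\<not> (d \<in> A \<and> p \<in> fst d)" for d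
    using assms that unfolding tangent_bundle_def mem_Collect_eq prod.case by blast
  have "v d = (if d \<in> A \<and> p \<in> fst d then frechet_derivative (transition c d) (at (snd c p)) (v c) else 0)" for d
    by (split if_split) (use comp[of d] zero[of d] in blast)
  then have "v = (\<lambda>d. if d \<in> A \<and> p \<in> fst d then frechet_derivative (transition c d) (at (snd c p)) (v c) else 0)"
    by (rule ext)
  then show ?thesis unfolding induced_chart[OF assms(2,3)] by (rule arg_cong)
qed

lemma finsler_metric_in_coordinates:
  assumes F: "finsler_metric M A F" and c: "c \<in> A"
  shows "finsler_in_coordinates (snd c ` fst c) (local_rep A c F)"
proof
  show "open (snd c ` fst c)" using open_chart_image[OF c] .
  show "smooth_on (local_rep A c F) (snd c ` fst c \<times> - {0})"
    using F c by (simp add: finsler_metric_def smooth_on_slit_def slit_domain_def)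
  show "y_homogeneous 1 (local_rep A c F) (snd c ` fst c)"
    unfolding y_homogeneous_def
  proof (intro ballI allI impI)
    fix x y :: "real ^ 'n" and t :: real
    assume x: "x \<in> snd c ` fst c" "y \<noteq> 0" "t > 0"
    then have "induced A c (x, y) \<in> tangent_bundle M A"
      using induced_in_slit_tangent_bundle[OF c, of "(x, y)"] by (auto simp: slit_domain_def slit_tangent_bundle_def)
    moreover have "\<forall>(p, v) \<in> tangent_bundle M A. \<forall>t>0. F (p, \<lambda>d. t *\<^sub>R v d) = t * F (p, v)"
      using F unfolding finsler_metric_def by blast
    ultimately have "F (fst (induced A c (x, y)), \<lambda>d. t *\<^sub>R snd (induced A c (x, y)) d) = t * F (induced A c (x, y))"
      using x(3) unfolding case_prod_beta prod.collapse by blast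
    then show "local_rep A c F (x, t *\<^sub>R y) = t ^ 1 * local_rep A c F (x, y)"
      by (simp add: local_rep_def induced_scaleR[OF c x(1)])
  qed
  show "invertible (metric_tensor (local_rep A c F) z)" if "z \<in> snd c ` fst c \<times> - {0}" for z
  proof -
    have "rank (metric_tensor (local_rep A c F) z) = CARD('n)"
      using F c that unfolding finsler_metric_def slit_domain_def by blast
    then show ?thesis unfolding invertible_det_nz det_eq_0_rank by simp
  qed
qed

end

section \<open>Nonexistence of parallel 1-forms\<close>

text \<open>Any two coefficients \<open>b\<^sub>i\<close>, \<open>b\<^sub>j\<close> give the kernel vector \<open>b\<^sub>j e\<^sub>i - b\<^sub>i e\<^sub>j\<close>, which is
  nonzero if \<open>b\<^sub>i\<close> is; otherwise \<open>e\<^sub>i\<close> itself is in the kernel. This is where dimension at least 2 enters.\<close>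

lemma ex_nonzero_kernel_vector:
  fixes b :: "'n::finite \<Rightarrow> real"
  assumes "CARD('n) \<ge> 2"
  obtains y :: "real ^ 'n" where "y \<noteq> 0" "(\<Sum>i\<in>UNIV. b i * y $ i) = 0"
proof -
  obtain i j :: 'n where "i \<noteq> j"
    using assms card_le_Suc0_iff_eq[of "UNIV :: 'n set"] by auto
  show ?thesis
  proof (cases "b i = 0")
    case True
    show ?thesis
    proof (rule that)
      show "axis i 1 \<noteq> (0 :: real ^ 'n)" by (simp add: axis_eq_0_iff)
      show "(\<Sum>k\<in>UNIV. b k * axis i 1 $ k) = 0"
        using True by (simp add: axis_def if_distrib cong: if_cong)
    qed
  next
    case False
    define y :: "real ^ 'n" where "y = b j *\<^sub>R axis i 1 - b i *\<^sub>R axis j 1"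
    have "y $ j = - b i" using \<open>i \<noteq> j\<close> by (simp add: y_def axis_def)
    then have "y \<noteq> 0" using False by auto
    moreover have axis: "(\<Sum>k\<in>UNIV. b k * axis l 1 $ k) = b l" for l
      by (simp add: axis_def if_distrib cong: if_cong)
    have "(\<Sum>k\<in>UNIV. b k * y $ k) =
        b j * (\<Sum>k\<in>UNIV. b k * axis i 1 $ k) - b i * (\<Sum>k\<in>UNIV. b k * axis j 1 $ k)"
      by (simp add: y_def right_diff_distrib sum_subtractf sum_distrib_left mult_ac)
    then have "(\<Sum>k\<in>UNIV. b k * y $ k) = 0" by (simp add: axis)
    ultimately show ?thesis by (rule that)
  qed
qed

theorem corollary4p3:
  fixes M :: "'a topology"
    and A :: "('a, 'n::finite) chart set"
    and F K :: "('a, 'n) tvec \<Rightarrow> real"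
  assumes "smooth_manifold M A"
    and "CARD('n) \<ge> 2"
    and "finsler_metric M A F"
    and "projectively_flat M A F"
    and "has_scalar_curvature A F K"
    and "\<forall>u \<in> slit_tangent_bundle M A. K u \<noteq> 0"
  shows "\<not> (\<exists>\<beta>. parallel_form A F \<beta> \<and> (\<exists>u \<in> tangent_bundle M A. \<beta> u \<noteq> 0))"
proof
  assume "\<exists>\<beta>. parallel_form A F \<beta> \<and> (\<exists>u \<in> tangent_bundle M A. \<beta> u \<noteq> 0)"
  then obtain \<beta> p v where \<beta>: "parallel_form A F \<beta>" and u: "(p, v) \<in> tangent_bundle M A" "\<beta> (p, v) \<noteq> 0"
    by (metis surj_pair)
  have "p \<in> topspace M" using u(1) unfolding tangent_bundle_def by blast
  moreover have "(\<Union>c\<in>A. fst c) = topspace M"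
    using assms(1) unfolding smooth_manifold_def by blast
  ultimately obtain c where c: "c \<in> A" "p \<in> fst c" by blast
  define x where "x = snd c p"
  define b where "b = form_coeff A c \<beta>"
  define L where "L = local_rep A c F"
  have form: "one_form A \<beta>" using \<beta> by (simp add: parallel_form_def)
  have x: "x \<in> snd c ` fst c" using c by (simp add: x_def)
  have "\<beta> (p, v) = local_rep A c \<beta> (x, v c)"
    unfolding local_rep_def x_def comp_def
    using tangent_vector_eq_induced[OF assms(1) u(1) c] by (rule arg_cong)
  also have "\<dots> = (\<Sum>i\<in>UNIV. b i x * v c $ i)"
    using form c(1) x by (auto simp: one_form_def b_def)
  finally have "\<exists>i. b i x \<noteq> 0"
    using u(2) sum.neutral[of UNIV "\<lambda>i. b i x * v c $ i"] by force
  then obtain i where i: "b i x \<noteq> 0" by blast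
  \<comment> \<open>A nonzero vector \<open>y\<close> with \<open>\<beta>(y) = 0\<close> removes the term with \<open>lowered_y\<close> from the
    contraction of \<open>b\<close> with the curvature.\<close>
  obtain y :: "real ^ 'n" where y: "y \<noteq> 0" "(\<Sum>h\<in>UNIV. b h x * y $ h) = 0"
    by (rule ex_nonzero_kernel_vector[OF assms(2), of "\<lambda>h. b h x"])
  define z where "z = (x, y)"
  have z: "z \<in> slit_domain c" using x y by (simp add: z_def slit_domain_def)
  interpret finsler_in_coordinates "snd c ` fst c" L
    unfolding L_def by (rule finsler_metric_in_coordinates[OF assms(1,3) c(1)])
  have "(\<Sum>h\<in>UNIV. b h (fst z) * riemann_curv L h i z) = 0"
  proof (rule parallel_form_annihilates_riemann_curv)
    show "smooth_on (b i) (snd c ` fst c)" for i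
      using form c(1) by (simp add: one_form_def b_def)
    show "horizontal_deriv L b i j w = 0" if "w \<in> slit" for i j w
      using \<beta> c(1) that unfolding parallel_form_def L_def b_def slit_domain_def by blast
    show "z \<in> slit" using z by (simp add: slit_domain_def)
  qed
  moreover have R: "riemann_curv L h i z = local_rep A c K z *
      ((L z)\<^sup>2 * (if h = i then 1 else 0) - lowered_y L i z * snd z $ h)" for h
    using assms(5) c(1) z unfolding has_scalar_curvature_def L_def by blast
  have "b h x * riemann_curv L h i z = local_rep A c K z *
      ((L z)\<^sup>2 * (if h = i then b h x else 0) - lowered_y L i z * (b h x * y $ h))" for h
    unfolding R by (simp add: z_def algebra_simps)
  ultimately have "local_rep A c K z * ((L z)\<^sup>2 * b i x) = 0"
    by (simp add: z_def sum_distrib_left[symmetric] sum_subtractf y(2))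
  moreover have "local_rep A c K z \<noteq> 0"
    using induced_in_slit_tangent_bundle[OF assms(1) c(1) z] assms(6) by (simp add: local_rep_def)
  moreover have "L z > 0"
    using induced_in_slit_tangent_bundle[OF assms(1) c(1) z] assms(3)
    unfolding finsler_metric_def by (simp only: local_rep_def L_def comp_def)
  ultimately show False using i by simp
qed

end
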